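(* Let $S$ be a numerical monoid. The element $\{1\}\in\mathcal P_{\mathrm{fin}}(\mathbb N_0)$ is absolutely irreducible. Apart from this element, there are no absolutely irreducible elements in $\mathcal P_{\mathrm{fin},0}(S)$ nor in $\mathcal P_{\mathrm{fin}}(S)$.
   Context: A numerical monoid is an additive submonoid $S\subset\mathbb N_0$ with $\gcd(S)=1$. $\mathcal P_{\mathrm{fin}}(S)$ is the monoid of finite nonempty subsets of $S$ under set addition (identity $\{0\}$, its only unit) and $\mathcal P_{\mathrm{fin},0}(S)$ its submonoid of sets containing $0$. In such a monoid $H$, an atom is an element $A\ne\{0\}$ such that $A=B+C$ with $B,C\in H$ forces $B=\{0\}$ or $C=\{0\}$. A factorization of $X\in H$ is a finite multiset of atoms of $H$ whose sum is $X$; $\mathsf Z(X)$ denotes the set of factorizations of $X$. An atom $A$ is absolutely irreducible if $|\mathsf Z(nA)|=1$ for all $n\in\mathbb N$, where $nA$ is the $n$-fold sum $A+\dots+A$. *)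

theory Defs
  imports Complex_Main "HOL-Library.Multiset" "HOL-Library.Set_Algebras"
begin

definition numerical_monoid :: "nat set \<Rightarrow> bool" where
  "numerical_monoid S \<longleftrightarrow> 0 \<in> S \<and> (\<forall>x\<in>S. \<forall>y\<in>S. x + y \<in> S) \<and> Gcd S = 1"

text \<open>
  Addition, the neutral element and sums on \<open>nat set\<close> are those of
  \<open>HOL-Library.Set_Algebras\<close>: \<open>A + B\<close> is the set of all \<open>a + b\<close>
  with \<open>a \<in> A\<close>, \<open>b \<in> B\<close>, and the neutral element is \<open>{0}\<close>.
  Submonoids of this monoid are given by their carriers \<open>H\<close>, and the notions
  below are all relative to \<open>H\<close>.
\<close>

definition P_fin :: "nat set \<Rightarrow> nat set set" where
  "P_fin S = {A. A \<subseteq> S \<and> finite A \<and> A \<noteq> {}}"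

definition P_fin0 :: "nat set \<Rightarrow> nat set set" where
  "P_fin0 S = {A \<in> P_fin S. 0 \<in> A}"

text \<open>The only unit of the monoids considered is \<open>{0}\<close>.\<close>

definition atom :: "nat set set \<Rightarrow> nat set \<Rightarrow> bool" where
  "atom H A \<longleftrightarrow> A \<in> H \<and> A \<noteq> {0} \<and>
     (\<forall>B\<in>H. \<forall>C\<in>H. A = B + C \<longrightarrow> B = {0} \<or> C = {0})"

definition factorizations :: "nat set set \<Rightarrow> nat set \<Rightarrow> nat set multiset set" where
  "factorizations H X = {F. (\<forall>A \<in># F. atom H A) \<and> \<Sum>\<^sub># F = X}"

definition absolutely_irreducible :: "nat set set \<Rightarrow> nat set \<Rightarrow> bool" where
  "absolutely_irreducible H A \<longleftrightarrow>
     atom H A \<and> (\<forall>n::nat. n \<ge> 1 \<longrightarrow> card (factorizations H (\<Sum>i<n. A)) = 1)"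

end

theory Submission
  imports Defs
begin

text \<open>
  If \<open>A\<close> is absolutely irreducible in \<open>H\<close>, then uniqueness of the factorization of \<open>nA\<close> forces
  every divisor of \<open>nA\<close> in \<open>H\<close> to be a multiple \<open>jA\<close>.  Let \<open>a\<close> and \<open>b\<close> be the minimum and the
  maximum of \<open>A\<close>.  If \<open>a < b\<close>, a pigeonhole argument gives \<open>(n + 1)A = {a, b} + nA\<close> for large \<open>n\<close>,
  so \<open>{a, b}\<close> is a multiple of \<open>A\<close> and hence \<open>A = {a, b}\<close>; but \<open>3{a, b} = {2a, 2b} + {a, b}\<close>, and
  \<open>{2a, 2b}\<close> is not a multiple of \<open>{a, b}\<close>.  If \<open>A = {s}\<close> with \<open>s > 1\<close>, some \<open>t \<in> S\<close> is not a
  multiple of \<open>s\<close>, while \<open>{t}\<close> divides \<open>t{s} = s{t}\<close>.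
\<close>

section \<open>n-fold sums of a set, and splitting off its extreme elements\<close>

lemma sum_mset_replicate_set:
  fixes A :: "nat set"
  shows "\<Sum>\<^sub># (replicate_mset n A) = (\<Sum>i<n. A)"
  by (induction n) (simp_all add: add.commute)

text \<open>Forgetting the order of the summands turns the exchange of summands into an operation on
  multisets.\<close>

lemma mem_n_fold_sum_iff:
  fixes A :: "nat set"
  shows "x \<in> (\<Sum>i<n. A) \<longleftrightarrow> (\<exists>M. size M = n \<and> set_mset M \<subseteq> A \<and> \<Sum>\<^sub># M = x)"
proof (induction n arbitrary: x)
  case 0
  then show ?case by auto
next
  case (Suc n)
  show ?case
  proof
    assume "x \<in> (\<Sum>i<Suc n. A)"
    then obtain y z where "y \<in> (\<Sum>i<n. A)" "z \<in> A" "x = y + z"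
      by (auto elim: set_plus_elim)
    moreover from this obtain M where "size M = n" "set_mset M \<subseteq> A" "\<Sum>\<^sub># M = y"
      using Suc.IH by blast
    ultimately show "\<exists>M. size M = Suc n \<and> set_mset M \<subseteq> A \<and> \<Sum>\<^sub># M = x"
      by (intro exI[of _ "add_mset z M"]) auto
  next
    assume "\<exists>M. size M = Suc n \<and> set_mset M \<subseteq> A \<and> \<Sum>\<^sub># M = x"
    then obtain M where M: "size M = Suc n" "set_mset M \<subseteq> A" "\<Sum>\<^sub># M = x" by blast
    then obtain z N where N: "M = add_mset z N" by (metis size_eq_Suc_imp_eq_union)
    with M have "\<Sum>\<^sub># N \<in> (\<Sum>i<n. A)" "z \<in> A" "x = \<Sum>\<^sub># N + z"
      using Suc.IH by auto
    then show "x \<in> (\<Sum>i<Suc n. A)" by (auto intro: set_plus_intro)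
  qed
qed

lemma mult_mem_n_fold_sum:
  fixes A :: "nat set"
  assumes "x \<in> A"
  shows "n * x \<in> (\<Sum>i<n. A)"
  using assms unfolding mem_n_fold_sum_iff
  by (intro exI[of _ "replicate_mset n x"]) auto

lemma n_fold_sum_le:
  fixes A :: "nat set"
  assumes "\<And>y. y \<in> A \<Longrightarrow> y \<le> b" "x \<in> (\<Sum>i<n. A)"
  shows "x \<le> n * b"
  using assms(2)
proof (induction n arbitrary: x)
  case (Suc n)
  then obtain y z where "y \<in> (\<Sum>i<n. A)" "z \<in> A" "x = y + z"
    by (auto elim: set_plus_elim)
  with Suc.IH[of y] assms(1)[of z] show ?case by simp
qed simp

lemma multiset_pigeonhole:
  assumes "finite A" "set_mset M \<subseteq> A" "card A * d < size M"
  shows "\<exists>y\<in>#M. d \<le> count M y"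
proof (rule ccontr)
  assume "\<not> ?thesis"
  then have "size M \<le> card (set_mset M) * d"
    using sum_bounded_above[of "set_mset M" "count M" d]
    by (simp add: size_multiset_overloaded_eq not_le less_imp_le)
  also have "\<dots> \<le> card A * d"
    using assms(1,2) by (intro mult_right_mono card_mono) auto
  finally show False using assms(3) by simp
qed

text \<open>The bound on \<open>n\<close> makes some \<open>y\<close> occur at least
  \<open>b - a\<close> times among \<open>n + 1\<close> summands. Trading \<open>b - a\<close>
  copies of \<open>y\<close> for copies of \<open>a\<close> and \<open>b\<close> changes neither the
  sum nor the number of summands, and one of the new summands can be split off.\<close>

lemma n_fold_sum_eq_extremes_plus:
  fixes A :: "nat set"
  assumes "a \<in> A" "b \<in> A" "a < b" "A \<subseteq> {a..b}" and n: "card A * (b - a) \<le> n"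
  shows "(\<Sum>i<Suc n. A) = {a, b} + (\<Sum>i<n. A)"
proof
  show "{a, b} + (\<Sum>i<n. A) \<subseteq> (\<Sum>i<Suc n. A)"
    using assms(1,2) by (simp add: add.commute[of _ A] set_plus_mono2)
  show "(\<Sum>i<Suc n. A) \<subseteq> {a, b} + (\<Sum>i<n. A)"
  proof
    fix x assume "x \<in> (\<Sum>i<Suc n. A)"
    then obtain M where M: "size M = Suc n" "set_mset M \<subseteq> A" "\<Sum>\<^sub># M = x"
      unfolding mem_n_fold_sum_iff by blast
    have "finite A" using assms(4) finite_subset by blast
    then obtain y where y: "y \<in># M" "b - a \<le> count M y"
      using multiset_pigeonhole[of A M "b - a"] M n by auto
    then obtain N where N: "M = replicate_mset (b - a) y + N"
      using count_le_replicate_mset_subset_eq subset_mset.le_iff_add by metis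
    have "y \<in> A" using y M by auto
    with assms(4) have "a \<le> y" "y \<le> b" by auto
    \<comment> \<open>The multiplicities \<open>y - a\<close> and \<open>b - y\<close> add up to
      \<open>b - a\<close>, and the weighted mean of \<open>b\<close> and \<open>a\<close> with
      these weights is \<open>y\<close>.\<close>
    define L where "L = replicate_mset (y - a) b + replicate_mset (b - y) a + N"
    have "size L = Suc n" using M(1) N \<open>a \<le> y\<close> \<open>y \<le> b\<close> unfolding L_def by simp
    have "set_mset L \<subseteq> A" using M(2) N assms(1,2) unfolding L_def by auto
    obtain u v where "y = a + u" "b = y + v"
      using \<open>a \<le> y\<close> \<open>y \<le> b\<close> by (metis le_iff_add)
    then have "(b - a) * y = (y - a) * b + (b - y) * a" by (simp add: algebra_simps)
    then have "\<Sum>\<^sub># L = x" using M(3) N unfolding L_def by simp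
    \<comment> \<open>If \<open>y = a\<close>, then \<open>L\<close> has \<open>b - y > 0\<close>
      copies of \<open>a\<close>; otherwise it has \<open>y - a > 0\<close> copies of
      \<open>b\<close>.\<close>
    obtain z where z: "z \<in> {a, b}" "z \<in># L"
      using \<open>a < b\<close> \<open>a \<le> y\<close> \<open>y \<le> b\<close> unfolding L_def
      by (cases "a = y") auto
    then obtain K where K: "L = add_mset z K" by (metis mset_add)
    have "\<Sum>\<^sub># K \<in> (\<Sum>i<n. A)"
      using K \<open>size L = Suc n\<close> \<open>set_mset L \<subseteq> A\<close> unfolding mem_n_fold_sum_iff by auto
    moreover have "x = z + \<Sum>\<^sub># K" using K \<open>\<Sum>\<^sub># L = x\<close> by simp
    ultimately show "x \<in> {a, b} + (\<Sum>i<n. A)"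
      using z(1) by (auto intro: set_plus_intro)
  qed
qed

section \<open>Existence of factorizations, and divisors of multiples of an atom\<close>

lemma Max_set_plus:
  fixes A B :: "nat set"
  assumes "finite A" "A \<noteq> {}" "finite B" "B \<noteq> {}"
  shows "Max (A + B) = Max A + Max B"
proof (rule Max_eqI)
  show "x \<le> Max A + Max B" if "x \<in> A + B" for x
    using that assms(1,3) by (auto elim!: set_plus_elim intro!: add_mono)
qed (use assms in \<open>auto intro: set_plus_intro finite_set_plus Max_in\<close>)

lemma Max_pos:
  fixes A :: "nat set"
  assumes "finite A" "A \<noteq> {}" "A \<noteq> {0}"
  shows "0 < Max A"
proof -
  obtain x where "x \<in> A" "x \<noteq> 0"
    using assms(2,3) subset_singletonD[of A 0] by auto
  then show ?thesis using Max_ge[OF assms(1)] by fastforce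
qed

text \<open>The maximum is additive and is positive on every set other than \<open>{0}\<close>, so
  it drops strictly in a proper decomposition and the induction can run on it.\<close>

lemma factorizations_nonempty:
  assumes "H \<subseteq> P_fin UNIV" "X \<in> H"
  shows "factorizations H X \<noteq> {}"
  using assms(2)
proof (induction "Max X" arbitrary: X rule: less_induct)
  case less
  consider "X = {0}" | "atom H X" | "X \<noteq> {0}" "\<not> atom H X" by blast
  then show ?case
  proof cases
    case 1
    then have "{#} \<in> factorizations H X" by (simp add: factorizations_def)
    then show ?thesis by blast
  next
    case 2
    then have "{#X#} \<in> factorizations H X" by (simp add: factorizations_def)
    then show ?thesis by blast
  next
    case 3
    then obtain B C where BC: "B \<in> H" "C \<in> H" "X = B + C" "B \<noteq> {0}" "C \<noteq> {0}"
      using less.prems by (auto simp: atom_def)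
    have fin: "finite B" "B \<noteq> {}" "finite C" "C \<noteq> {}"
      using BC(1,2) assms(1) by (auto simp: P_fin_def)
    then have "Max B < Max X" "Max C < Max X"
      using Max_pos[of B] Max_pos[of C] BC(3-5) by (simp_all add: Max_set_plus)
    then obtain F G where "F \<in> factorizations H B" "G \<in> factorizations H C"
      using less.hyps BC(1,2) by blast
    then have "F + G \<in> factorizations H X"
      using BC(3) by (auto simp: factorizations_def)
    then show ?thesis by blast
  qed
qed

text \<open>Joining factorizations of \<open>B\<close> and \<open>C\<close> gives one of the n-fold
  sum, which by uniqueness consists of \<open>n\<close> copies of \<open>A\<close>; the part that
  belongs to \<open>B\<close> then also consists of copies of \<open>A\<close>.\<close>

lemma absolutely_irreducible_divisor:
  fixes n :: nat
  assumes H: "H \<subseteq> P_fin UNIV" and A: "absolutely_irreducible H A"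
    and "1 \<le> n" "(\<Sum>i<n. A) = B + C" "B \<in> H" "C \<in> H"
  obtains j :: nat where "B = (\<Sum>i<j. A)"
proof -
  obtain F G where FG: "F \<in> factorizations H B" "G \<in> factorizations H C"
    using factorizations_nonempty[OF H] assms(5,6) by blast
  then have "F + G \<in> factorizations H (\<Sum>i<n. A)"
    using assms(4) by (auto simp: factorizations_def)
  moreover have "replicate_mset n A \<in> factorizations H (\<Sum>i<n. A)"
    using A by (auto simp: factorizations_def absolutely_irreducible_def sum_mset_replicate_set)
  moreover have "card (factorizations H (\<Sum>i<n. A)) = 1"
    using A \<open>1 \<le> n\<close> by (simp add: absolutely_irreducible_def)
  ultimately have "F + G = replicate_mset n A"
    by (metis card_1_singletonE singletonD)
  then have "F \<subseteq># replicate_mset n A" by (metis mset_subset_eq_add_left)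
  then obtain j where "F = replicate_mset j A" by (metis msubseteq_replicate_msetE)
  then have "B = (\<Sum>i<j. A)"
    using FG(1) by (simp add: factorizations_def sum_mset_replicate_set)
  then show ?thesis by (rule that)
qed

section \<open>Sets with at least two elements\<close>

lemma P_fin_mono: "S \<subseteq> T \<Longrightarrow> P_fin S \<subseteq> P_fin T"
  by (auto simp: P_fin_def)

lemma set_plus_mem_P_fin:
  assumes "numerical_monoid S" "A \<in> P_fin S" "B \<in> P_fin S"
  shows "A + B \<in> P_fin S"
  using assms by (auto simp: P_fin_def numerical_monoid_def finite_set_plus set_plus_def)

lemma n_fold_sum_mem:
  fixes n :: nat
  assumes S: "numerical_monoid S" and H: "H \<in> {P_fin S, P_fin0 S}" and "A \<in> H"
  shows "(\<Sum>i<n. A) \<in> H"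
proof (induction n)
  case 0
  then show ?case using S H by (auto simp: P_fin_def P_fin0_def numerical_monoid_def)
next
  case (Suc n)
  have "0 \<in> B + C" if "0 \<in> B" "0 \<in> C" for B C :: "nat set"
    using set_plus_intro[OF that] by simp
  with Suc \<open>A \<in> H\<close> H set_plus_mem_P_fin[OF S] show ?case
    by (auto simp: P_fin0_def)
qed

lemma not_absolutely_irreducible_nonsingleton:
  assumes S: "numerical_monoid S" and H: "H \<in> {P_fin S, P_fin0 S}"
    and "x \<in> A" "y \<in> A" "x \<noteq> y"
  shows "\<not> absolutely_irreducible H A"
proof
  assume A: "absolutely_irreducible H A"
  have HU: "H \<subseteq> P_fin UNIV" using H by (auto simp: P_fin_def P_fin0_def)
  have "A \<in> H" using A by (simp add: absolutely_irreducible_def atom_def)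
  then have fin: "finite A" and "A \<subseteq> S" using H by (auto simp: P_fin_def P_fin0_def)
  define a b where "a = Min A" and "b = Max A"
  have ab: "a \<in> A" "b \<in> A" "A \<subseteq> {a..b}"
    using fin \<open>x \<in> A\<close> unfolding a_def b_def by (auto intro: Min_in Max_in)
  have "a < b" using subsetD[OF ab(3) \<open>x \<in> A\<close>] subsetD[OF ab(3) \<open>y \<in> A\<close>] \<open>x \<noteq> y\<close> by auto
  \<comment> \<open>For \<open>H = P_fin0 S\<close> this places \<open>0\<close> in
    \<open>{a, b}\<close> and in \<open>{2 * a, 2 * b}\<close>, so that both lie in
    \<open>H\<close>.\<close>
  have a0: "a = 0" if "0 \<in> A" using ab(3) that by auto
  have nA: "(\<Sum>i<n. A) \<in> H" for n :: nat by (rule n_fold_sum_mem[OF S H \<open>A \<in> H\<close>])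
  \<comment> \<open>The multiplier is read off from the maxima: \<open>j * b\<close> lies in the
    two-element set and is at least \<open>m * b\<close>, which leaves only
    \<open>m * b\<close>.\<close>
  have multiple: "j = m" if "{m * a, m * b} = (\<Sum>i<j. A)" "0 < m" for j m :: nat
  proof -
    have "j * b \<in> {m * a, m * b}" unfolding that(1) by (rule mult_mem_n_fold_sum[OF ab(2)])
    moreover have "m * b \<in> (\<Sum>i<j. A)" using that(1) by blast
    then have "m * b \<le> j * b" using ab(3) by (intro n_fold_sum_le[of A]) auto
    moreover have "m * a < m * b" using \<open>a < b\<close> \<open>0 < m\<close> by simp
    ultimately have "j * b = m * b" by auto
    then show ?thesis using \<open>a < b\<close> by simp
  qed
  have "{a, b} \<in> H"
    using H ab \<open>A \<subseteq> S\<close> \<open>A \<in> H\<close> a0 by (auto simp: P_fin_def P_fin0_def)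
  then obtain j :: nat where j: "{a, b} = (\<Sum>i<j. A)"
    using absolutely_irreducible_divisor[OF HU A _
        n_fold_sum_eq_extremes_plus[OF ab(1,2) \<open>a < b\<close> ab(3) order_refl] _ nA] by auto
  with multiple[of 1 j] have Aab: "A = {a, b}" by auto
  have "{2 * a, 2 * b} \<in> H"
  proof -
    have "2 * x \<in> S" if "x \<in> A" for x
      using S that \<open>A \<subseteq> S\<close> by (auto simp: numerical_monoid_def mult_2)
    then show ?thesis
      using H ab(1,2) \<open>A \<in> H\<close> a0 by (auto simp: P_fin_def P_fin0_def)
  qed
  \<comment> \<open>Both sides are \<open>{3a, 2a + b, a + 2b, 3b}\<close>.\<close>
  moreover have "(\<Sum>i<3::nat. A) = {2 * a, 2 * b} + A"
    unfolding Aab by (auto simp: numeral_3_eq_3 set_plus_def)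
  ultimately obtain k :: nat where k: "{2 * a, 2 * b} = (\<Sum>i<k. A)"
    using absolutely_irreducible_divisor[OF HU A, of 3 "{2 * a, 2 * b}" A] \<open>A \<in> H\<close> by auto
  with multiple[of 2 k] have "{2 * a, 2 * b} = A + A" by (simp add: numeral_2_eq_2)
  \<comment> \<open>The contradiction: \<open>a + b\<close> lies strictly between
    \<open>2 * a\<close> and \<open>2 * b\<close>.\<close>
  then have "a + b \<in> {2 * a, 2 * b}" using ab(1,2) by (metis set_plus_intro)
  with \<open>a < b\<close> show False by auto
qed

section \<open>Singletons other than \<open>{1}\<close>\<close>

lemma n_fold_sum_singleton:
  fixes n s :: nat
  shows "(\<Sum>i<n. {s}) = {n * s}"
  by (induction n) (simp_all add: set_plus_def add.commute)

lemma not_absolutely_irreducible_singleton: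
  assumes S: "numerical_monoid S" and "s \<noteq> 1"
  shows "\<not> absolutely_irreducible (P_fin S) {s}"
proof
  assume A: "absolutely_irreducible (P_fin S) {s}"
  have "{s} \<in> P_fin S" "s \<noteq> 0" using A by (auto simp: absolutely_irreducible_def atom_def)
  have "\<not> s dvd Gcd S" using S \<open>s \<noteq> 1\<close> by (simp add: numerical_monoid_def)
  then obtain t where t: "t \<in> S" "\<not> s dvd t" by (auto intro: Gcd_greatest)
  then have "1 \<le> t" by (cases t) auto
  have "{t} \<in> P_fin S" using t by (simp add: P_fin_def)
  \<comment> \<open>Both sides are \<open>{s * t}\<close>; as \<open>s\<close> is positive, one of
    the \<open>s\<close> copies of \<open>{t}\<close> can be split off.\<close>
  moreover have "(\<Sum>i<t. {s}) = {t} + (\<Sum>i<s - 1. {t})"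
    unfolding n_fold_sum_singleton using \<open>s \<noteq> 0\<close>
    by (cases s) (auto simp: set_plus_def algebra_simps)
  ultimately obtain j :: nat where "{t} = (\<Sum>i<j. {s})"
    using absolutely_irreducible_divisor[OF P_fin_mono[OF subset_UNIV] A \<open>1 \<le> t\<close>]
      n_fold_sum_mem[OF S, of "P_fin S" "{t}"] by blast
  with t(2) show False by (simp add: n_fold_sum_singleton)
qed

section \<open>Absolute irreducibility of \<open>{1}\<close>\<close>

lemma set_plus_eq_singletonE:
  fixes B C :: "nat set"
  assumes "B + C = {n}" 
  obtains b c where "B = {b}" "C = {c}" "b + c = n"
proof -
  obtain b c where bc: "b \<in> B" "c \<in> C" "b + c = n"
    using assms by (metis insertI1 set_plus_elim)
  have sum: "x + y = n" if "x \<in> B" "y \<in> C" for x y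
    using set_plus_intro[OF that] assms by simp
  have "x = b" if "x \<in> B" for x using sum[OF that bc(2)] bc(3) by simp
  then have "B = {b}" using bc(1) by blast
  moreover have "y = c" if "y \<in> C" for y using sum[OF bc(1) that] bc(3) by simp
  then have "C = {c}" using bc(2) by blast
  ultimately show ?thesis using bc(3) by (rule that)
qed

lemma atom_one: "atom (P_fin UNIV) {1}"
  unfolding atom_def
proof (intro conjI ballI impI)
  fix B C :: "nat set"
  assume "{1} = B + C"
  then obtain b c where "B = {b}" "C = {c}" "b + c = (1::nat)"
    by (metis set_plus_eq_singletonE)
  then show "B = {0} \<or> C = {0}" by (cases b) auto
qed (auto simp: P_fin_def)

text \<open>Any positive \<open>k\<close> splits as \<open>1 + (k - 1)\<close>, which is a proper
  decomposition unless \<open>k = 1\<close>.\<close>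

lemma atom_singletonD:
  assumes "atom (P_fin UNIV) {k}"
  shows "k = 1"
proof -
  have "{k} \<noteq> {0}" using assms by (simp add: atom_def)
  then have "{k} = {1} + {k - 1}" by (auto simp: set_plus_def)
  moreover have "{1} \<in> P_fin UNIV" "{k - 1} \<in> P_fin UNIV" by (auto simp: P_fin_def)
  ultimately have "{1::nat} = {0} \<or> {k - 1} = {0}" using assms unfolding atom_def by blast
  with \<open>{k} \<noteq> {0}\<close> show ?thesis by auto
qed

text \<open>All divisors of a singleton are singletons and the only singleton atom is
  \<open>{1}\<close>, so the sum fixes the number of its copies.\<close>

lemma factorization_of_singleton:
  assumes "F \<in> factorizations (P_fin UNIV) {n}"
  shows "F = replicate_mset n {1}"
  using assms
proof (induction F arbitrary: n)
  case empty
  then show ?case by (simp add: factorizations_def)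
next
  case (add A F)
  then have "A + \<Sum>\<^sub># F = {n}" "atom (P_fin UNIV) A" by (auto simp: factorizations_def)
  then obtain b c where bc: "A = {b}" "\<Sum>\<^sub># F = {c}" "b + c = n"
    by (metis set_plus_eq_singletonE)
  with add.prems have "F = replicate_mset c {1}"
    by (intro add.IH) (simp add: factorizations_def)
  moreover have "b = 1" using atom_singletonD \<open>atom _ A\<close> bc(1) by simp
  ultimately show ?case using bc by auto
qed

lemma absolutely_irreducible_one: "absolutely_irreducible (P_fin UNIV) {1}"
  unfolding absolutely_irreducible_def
proof (intro conjI allI impI)
  fix n :: nat
  have "replicate_mset n {1} \<in> factorizations (P_fin UNIV) {n}"
    using atom_one
    by (auto simp: factorizations_def sum_mset_replicate_set n_fold_sum_singleton)
  then have "factorizations (P_fin UNIV) {n} = {replicate_mset n {1}}"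
    using factorization_of_singleton by blast
  then show "card (factorizations (P_fin UNIV) (\<Sum>i<n. {1})) = 1"
    by (simp add: n_fold_sum_singleton)
qed (rule atom_one)

theorem theorem4p11:
  fixes S :: "nat set"
  assumes "numerical_monoid S"
  shows "absolutely_irreducible (P_fin UNIV) {1} \<and>
    \<not> (\<exists>A. absolutely_irreducible (P_fin0 S) A) \<and>
    \<not> (\<exists>A. absolutely_irreducible (P_fin S) A \<and> A \<noteq> {1})"
proof (intro conjI notI)
  assume "\<exists>A. absolutely_irreducible (P_fin0 S) A"
  then obtain A where A: "absolutely_irreducible (P_fin0 S) A" by blast
  then have "0 \<in> A" "A \<noteq> {0}"
    by (auto simp: absolutely_irreducible_def atom_def P_fin0_def)
  \<comment> \<open>An atom of \<open>P_fin0 S\<close> contains \<open>0\<close> and differs from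
    \<open>{0}\<close>, so it always has two distinct elements.\<close>
  then obtain x where "x \<in> A" "x \<noteq> 0" by blast
  with A \<open>0 \<in> A\<close> not_absolutely_irreducible_nonsingleton[OF assms] show False by blast
next
  assume "\<exists>A. absolutely_irreducible (P_fin S) A \<and> A \<noteq> {1}"
  then obtain A where A: "absolutely_irreducible (P_fin S) A" "A \<noteq> {1}" by blast
  then have "A \<noteq> {}"
    by (auto simp: absolutely_irreducible_def atom_def P_fin_def)
  then obtain s where "s \<in> A" by blast
  have "A = {s}"
    using A(1) \<open>s \<in> A\<close> not_absolutely_irreducible_nonsingleton[OF assms] by blast
  with A not_absolutely_irreducible_singleton[OF assms] show False by auto
qed (rule absolutely_irreducible_one)

end
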